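(* Let $G$ be a graph with $n$ vertices and $M=M[IAS(G)]$. Then \[\kappa_B(G)=\begin{cases}\frac{\kappa(M)+1}{2}&\text{if }\kappa(M)<n,\\ \infty&\text{otherwise.}\end{cases}\]
   Context: A graph is a finite looped simple graph; $A=A(G)$ is its $GF(2)$ adjacency matrix (diagonal entry $1$ iff looped, off-diagonal entries record non-loop adjacency), and $n=|V(G)|$. $M[IAS(G)]$ is the binary matroid represented by $(I\;A\;A+I)$. For a matroid $M$ on $W$ with rank $r$, $\lambda(S)=r(S)+r(W-S)-r(M)$; $S$ is a vertical $k$-separation if $\lambda(S)<k$ and $r(S),r(W-S)\ge k$; $\kappa(M)=\min(\{k\mid M\text{ has a vertical }k\text{-separation}\}\cup\{r(M)\})$. The cut-rank of $X\subseteq V(G)$ is $c_G(X)=r(A[V(G)-X,X])$, the $GF(2)$-rank of the submatrix with rows in $V(G)-X$ and columns in $X$ (empty matrix has rank 0). A subset $X\subseteq V(G)$ is an isotropic $k$-separation if $|X|,|V(G)-X|\ge k$ and $c_G(X)<k$. The isotropic connectivity $\kappa_B(G)$ is the least $k$ such that $G$ has an isotropic $k$-separation, or $\infty$ if there is none. *)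

theory Defs
  imports Complex_Main "HOL-Library.Function_Algebras" "HOL-Library.Z2" "HOL-Library.Extended_Real"
begin

global_interpretation fun_vs: vector_space "\<lambda>(c::'f::field) (f::'a \<Rightarrow> 'f) x. c * f x"
  by unfold_locales (auto simp: fun_eq_iff algebra_simps)

definition mat_col :: "'r set \<Rightarrow> ('r \<Rightarrow> 'c \<Rightarrow> 'f::field) \<Rightarrow> 'c \<Rightarrow> 'r \<Rightarrow> 'f" where
  "mat_col R B c = (\<lambda>r. if r \<in> R then B r c else 0)"

definition mat_rank :: "'r set \<Rightarrow> 'c set \<Rightarrow> ('r \<Rightarrow> 'c \<Rightarrow> 'f::field) \<Rightarrow> nat" where
  "mat_rank R C B = fun_vs.dim (mat_col R B ` C)"

text \<open>A matroid is given as a pair of its ground set and its family of independent sets.\<close>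

type_synonym 'a matroid = "'a set \<times> 'a set set"

definition is_matroid :: "'a matroid \<Rightarrow> bool" where
  "is_matroid M \<longleftrightarrow> finite (fst M) \<and> snd M \<subseteq> Pow (fst M) \<and> {} \<in> snd M \<and>
     (\<forall>I J. I \<in> snd M \<longrightarrow> J \<subseteq> I \<longrightarrow> J \<in> snd M) \<and>
     (\<forall>I\<in>snd M. \<forall>J\<in>snd M. card J < card I \<longrightarrow> (\<exists>x\<in>I - J. insert x J \<in> snd M))"

definition matroid_rank :: "'a matroid \<Rightarrow> 'a set \<Rightarrow> nat" where
  "matroid_rank M S = Max {card I | I. I \<in> snd M \<and> I \<subseteq> S}"

definition matroid_lambda :: "'a matroid \<Rightarrow> 'a set \<Rightarrow> int" where
  "matroid_lambda M S =
     int (matroid_rank M S) + int (matroid_rank M (fst M - S)) - int (matroid_rank M (fst M))"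

definition vertical_separation :: "'a matroid \<Rightarrow> nat \<Rightarrow> 'a set \<Rightarrow> bool" where
  "vertical_separation M k S \<longleftrightarrow> S \<subseteq> fst M \<and> matroid_lambda M S < int k \<and>
     matroid_rank M S \<ge> k \<and> matroid_rank M (fst M - S) \<ge> k"

definition vertical_connectivity :: "'a matroid \<Rightarrow> nat" where
  "vertical_connectivity M =
     (LEAST k. k \<in> {k. \<exists>S. vertical_separation M k S} \<union> {matroid_rank M (fst M)})"

text \<open>The matroid represented by a matrix: a set of column labels is independent iff the
  corresponding family of columns is linearly independent, so distinct labels of equal columns
  form a dependent set.\<close>

definition represented_matroid :: "'r set \<Rightarrow> 'c set \<Rightarrow> ('r \<Rightarrow> 'c \<Rightarrow> 'f::field) \<Rightarrow> 'c matroid" where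
  "represented_matroid R C B =
     (C, {I. I \<subseteq> C \<and> inj_on (mat_col R B) I \<and> fun_vs.independent (mat_col R B ` I)})"

lemma is_matroid_represented_matroid:
  fixes B :: "'r \<Rightarrow> 'c \<Rightarrow> 'f::field"
  assumes "finite C"
  shows "is_matroid (represented_matroid R C B)"
proof -
  let ?c = "mat_col R B"
  have "\<exists>x\<in>I - J. inj_on ?c (insert x J) \<and> fun_vs.independent (?c ` insert x J)"
    if I: "I \<subseteq> C" "inj_on ?c I" "fun_vs.independent (?c ` I)"
      and J: "J \<subseteq> C" "inj_on ?c J" "fun_vs.independent (?c ` J)"
      and less: "card J < card I" for I J
  proof -
    have fin: "finite I" "finite J" using I(1) J(1) assms finite_subset by auto
    have "\<not> ?c ` I \<subseteq> fun_vs.span (?c ` J)"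
      using fun_vs.independent_span_bound[of "?c ` J" "?c ` I"] fin I J less
      by (auto simp: card_image)
    then obtain x where x: "x \<in> I" "?c x \<notin> fun_vs.span (?c ` J)" by auto
    then have "?c x \<notin> ?c ` J" using fun_vs.span_base by blast
    then have "x \<notin> J" "inj_on ?c (insert x J)" using J(2) by auto
    moreover have "fun_vs.independent (?c ` insert x J)"
      using fun_vs.independent_insertI[OF x(2) J(3)] by simp
    ultimately show ?thesis using x(1) by auto
  qed
  note augment = this
  let ?\<I> = "{I. I \<subseteq> C \<and> inj_on ?c I \<and> fun_vs.independent (?c ` I)}"
  have "{} \<in> ?\<I>" by (simp add: fun_vs.independent_empty)
  moreover have "J \<in> ?\<I>" if "I \<in> ?\<I>" "J \<subseteq> I" for I J
  proof -
    have "fun_vs.independent (?c ` J)"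
      using that fun_vs.independent_mono[of "?c ` I" "?c ` J"] by (simp add: image_mono)
    then show ?thesis using that inj_on_subset by blast
  qed
  moreover have "\<exists>x\<in>I - J. insert x J \<in> ?\<I>" if "I \<in> ?\<I>" "J \<in> ?\<I>" "card J < card I" for I J
    using augment[of I J] that by blast
  ultimately show ?thesis
    using assms unfolding is_matroid_def represented_matroid_def fst_conv snd_conv by blast
qed

text \<open>A loop at \<open>v\<close> is the edge \<open>{v}\<close>.\<close>

definition looped_simple_graph :: "'v set \<Rightarrow> 'v set set \<Rightarrow> bool" where
  "looped_simple_graph V E \<longleftrightarrow> finite V \<and> (\<forall>e\<in>E. e \<subseteq> V \<and> card e \<in> {1, 2})"

definition adj_mat :: "'v set set \<Rightarrow> 'v \<Rightarrow> 'v \<Rightarrow> bit" where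
  "adj_mat E v w = (if {v, w} \<in> E then 1 else 0)"

definition id_mat :: "'v \<Rightarrow> 'v \<Rightarrow> bit" where
  "id_mat v w = (if v = w then 1 else 0)"

datatype block = Block_I | Block_A | Block_AI

fun ias_mat :: "'v set set \<Rightarrow> 'v \<Rightarrow> 'v \<times> block \<Rightarrow> bit" where
  "ias_mat E v (w, Block_I) = id_mat v w"
| "ias_mat E v (w, Block_A) = adj_mat E v w"
| "ias_mat E v (w, Block_AI) = adj_mat E v w + id_mat v w"

definition isotropic_matroid :: "'v set \<Rightarrow> 'v set set \<Rightarrow> ('v \<times> block) matroid" where
  "isotropic_matroid V E = represented_matroid V (V \<times> UNIV) (ias_mat E)"

definition cut_rank :: "'v set \<Rightarrow> 'v set set \<Rightarrow> 'v set \<Rightarrow> nat" where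
  "cut_rank V E X = mat_rank (V - X) X (adj_mat E)"

definition isotropic_separation :: "'v set \<Rightarrow> 'v set set \<Rightarrow> nat \<Rightarrow> 'v set \<Rightarrow> bool" where
  "isotropic_separation V E k X \<longleftrightarrow>
     X \<subseteq> V \<and> card X \<ge> k \<and> card (V - X) \<ge> k \<and> cut_rank V E X < k"

definition isotropic_connectivity :: "'v set \<Rightarrow> 'v set set \<Rightarrow> enat" where
  "isotropic_connectivity V E =
     (if \<exists>k X. isotropic_separation V E k X
      then enat (LEAST k. \<exists>X. isotropic_separation V E k X) else \<infinity>)"

end

theory Submission
  imports Defs
begin

text \<open>
  Write \<open>\<tau>(X)\<close> for the set of all columns labelled by a vertex of \<open>X\<close>, and \<open>c\<close> for the cut-rank.
  Clearing the rows of \<open>X\<close> with the unit columns gives \<open>r(\<tau>(X)) = |X| + c(X)\<close>, and since \<open>c\<close> is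
  symmetric under complementation, \<open>\<lambda>(\<tau>(X)) = 2 c(X)\<close>. Hence an isotropic \<open>k\<close>-separation \<open>X\<close> with
  \<open>k\<close> minimal, where \<open>c(X) = k - 1\<close>, yields the vertical \<open>(2k-1)\<close>-separation \<open>\<tau>(X)\<close>.

  Conversely, the three columns of a vertex sum to zero, so any two of them span the third. Given a
  vertical \<open>k\<close>-separation \<open>S\<close>, let \<open>X\<close> be the set of vertices with at least two columns in \<open>S\<close>. Then
  \<open>S\<close> spans \<open>\<tau>(X)\<close> and the complement of \<open>S\<close> spans \<open>\<tau>(V - X)\<close>, so \<open>2 c(X) \<le> \<lambda>(S) < k\<close>. If
  \<open>|X| \<le> c(X)\<close>, then \<open>r(\<tau>(V - X)) \<ge> n\<close>, so the complement of \<open>S\<close> has full rank and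
  \<open>\<lambda>(S) = r(S) \<ge> k\<close>, a contradiction; likewise for \<open>V - X\<close>. So \<open>X\<close> is an isotropic
  \<open>(c(X) + 1)\<close>-separation, and \<open>2 (c(X) + 1) - 1 \<le> k\<close>.
\<close>

section \<open>Spans, dimension and disjoint supports in spaces of functions\<close>

lemma fun_vs_card_le_dim:
  fixes T :: "('a \<Rightarrow> 'f::field) set"
  assumes "finite S" "fun_vs.independent T" "T \<subseteq> fun_vs.span S"
  shows "finite T \<and> card T \<le> fun_vs.dim S"
proof -
  obtain B where B: "B \<subseteq> S" "fun_vs.independent B" "S \<subseteq> fun_vs.span B" "card B = fun_vs.dim S"
    by (rule fun_vs.basis_exists)
  have "finite B" using B(1) assms(1) finite_subset by blast
  moreover have "T \<subseteq> fun_vs.span B"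
    using assms(3) fun_vs.span_minimal[OF B(3) fun_vs.subspace_span] by blast
  ultimately show ?thesis
    using fun_vs.independent_span_bound[of B T] assms(2) B(4) by simp
qed

lemma fun_vs_dim_le:
  fixes T :: "('a \<Rightarrow> 'f::field) set"
  assumes "finite S" "T \<subseteq> fun_vs.span S"
  shows "fun_vs.dim T \<le> fun_vs.dim S"
proof -
  obtain B where B: "B \<subseteq> T" "fun_vs.independent B" "T \<subseteq> fun_vs.span B" "card B = fun_vs.dim T"
    by (rule fun_vs.basis_exists)
  then show ?thesis
    using fun_vs_card_le_dim[of S B] assms by (metis subset_trans)
qed

lemma fun_vs_dim_span_eq:
  fixes T :: "('a \<Rightarrow> 'f::field) set"
  assumes "finite S" "finite T" "S \<subseteq> fun_vs.span T" "T \<subseteq> fun_vs.span S"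
  shows "fun_vs.dim S = fun_vs.dim T"
  using assms by (intro antisym fun_vs_dim_le)

text \<open>Vanishing at a point is a linear condition, so it passes to the span.\<close>

lemma fun_vs_span_zero_on:
  fixes S :: "('a \<Rightarrow> 'f::field) set"
  assumes "f \<in> fun_vs.span S" "\<And>g x. g \<in> S \<Longrightarrow> x \<in> X \<Longrightarrow> g x = 0" "x \<in> X"
  shows "f x = 0"
  using assms(1)
proof (induction rule: fun_vs.span_induct_alt)
  case base
  then show ?case by simp
next
  case (step c g h)
  then show ?case using assms(2,3) by simp
qed

lemma fun_vs_independent_disjoint_support:
  fixes S T :: "('a \<Rightarrow> 'f::field) set"
  assumes "finite T" "fun_vs.independent T" "fun_vs.independent S"
    and S: "\<And>f x. f \<in> S \<Longrightarrow> x \<in> - X \<Longrightarrow> f x = 0"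
    and T: "\<And>f x. f \<in> T \<Longrightarrow> x \<in> X \<Longrightarrow> f x = 0"
  shows "fun_vs.independent (S \<union> T)"
  using assms(1,2) T
proof (induction rule: finite_induct)
  case empty
  then show ?case using assms(3) by simp
next
  case (insert t T)
  have tT: "t \<notin> fun_vs.span T" and indT: "fun_vs.independent T"
    using insert.prems(1) insert.hyps by (auto simp: fun_vs.independent_insert)
  have "t \<notin> fun_vs.span (S \<union> T)"
  proof
    assume "t \<in> fun_vs.span (S \<union> T)"
    then obtain a b where ab: "t = a + b" "a \<in> fun_vs.span S" "b \<in> fun_vs.span T"
      unfolding fun_vs.span_Un by blast
    \<comment> \<open>Here \<open>a = t - b\<close>: the right side vanishes on \<open>X\<close>,
      the left side off \<open>X\<close>.\<close>
    have "a x = 0" for x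
    proof (cases "x \<in> X")
      case True
      then have "t x = 0" "b x = 0"
        using insert.prems(2) fun_vs_span_zero_on[OF ab(3), of X x] by auto
      then show ?thesis using ab(1) by simp
    next
      case False
      then show ?thesis using fun_vs_span_zero_on[OF ab(2), of "- X" x] S by auto
    qed
    then have "t = b" using ab(1) by (simp add: fun_eq_iff)
    then show False using ab(3) tT by simp
  qed
  moreover have "fun_vs.independent (S \<union> T)"
    using insert.IH indT insert.prems(2) by blast
  ultimately show ?case using fun_vs.independent_insertI by simp
qed

text \<open>Bases of the two sides are disjoint, since a common member would be zero everywhere, and
  together they form a basis of the union.\<close>

lemma fun_vs_dim_disjoint_support:
  fixes S T :: "('a \<Rightarrow> 'f::field) set"
  assumes "finite S" "finite T"
    and S0: "\<And>f x. f \<in> S \<Longrightarrow> x \<in> - X \<Longrightarrow> f x = 0"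
    and T0: "\<And>f x. f \<in> T \<Longrightarrow> x \<in> X \<Longrightarrow> f x = 0"
  shows "fun_vs.dim (S \<union> T) = fun_vs.dim S + fun_vs.dim T"
proof -
  obtain B where B: "B \<subseteq> S" "fun_vs.independent B" "S \<subseteq> fun_vs.span B" "card B = fun_vs.dim S"
    by (rule fun_vs.basis_exists)
  obtain D where D: "D \<subseteq> T" "fun_vs.independent D" "T \<subseteq> fun_vs.span D" "card D = fun_vs.dim T"
    by (rule fun_vs.basis_exists)
  have fin: "finite B" "finite D" using B(1) D(1) assms(1,2) finite_subset by auto
  have ind: "fun_vs.independent (B \<union> D)"
    by (rule fun_vs_independent_disjoint_support[OF fin(2) D(2) B(2), of X])
      (use B(1) D(1) S0 T0 in blast)+
  have "f \<notin> D" if "f \<in> B" for f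
  proof
    assume "f \<in> D"
    then have "f x = 0" for x using that B(1) D(1) S0[of f x] T0[of f x] by blast
    then have "f = 0" by (simp add: fun_eq_iff)
    then show False using that B(2) fun_vs.dependent_zero by blast
  qed
  then have "card (B \<union> D) = card B + card D"
    using fin by (intro card_Un_disjoint) auto
  moreover have "fun_vs.dim (S \<union> T) = card (B \<union> D)"
  proof (rule fun_vs.dim_unique)
    show "S \<union> T \<subseteq> fun_vs.span (B \<union> D)"
      using B(3) D(3) fun_vs.span_mono[of B "B \<union> D"] fun_vs.span_mono[of D "B \<union> D"] by auto
  qed (use B(1) D(1) ind in auto)
  ultimately show ?thesis using B(4) D(4) by simp
qed

section \<open>Row rank equals column rank\<close>

lemma sum_fun_apply: "(\<Sum>a\<in>A. f a) x = (\<Sum>a\<in>A. f a x)"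
  by (induction A rule: infinite_finite_induct) auto

text \<open>Expanding the rows in a basis \<open>U\<close> of the row space factors the matrix through \<open>|U|\<close>
  coordinates, so the columns lie in the span of \<open>|U|\<close> vectors.\<close>

lemma mat_rank_le_transpose:
  assumes "finite R"
  shows "mat_rank R C B \<le> mat_rank C R (\<lambda>c r. B r c)"
proof -
  let ?row = "mat_col C (\<lambda>c r. B r c)"
  obtain U where U: "U \<subseteq> ?row ` R" "fun_vs.independent U"
    "?row ` R \<subseteq> fun_vs.span U" "card U = fun_vs.dim (?row ` R)"
    by (rule fun_vs.basis_exists)
  have finU: "finite U" using U(1) assms finite_surj by blast
  have "\<forall>r. \<exists>a. r \<in> R \<longrightarrow> ?row r = (\<Sum>u\<in>U. (\<lambda>x. a u * u x))"
  proof
    fix r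
    show "\<exists>a. r \<in> R \<longrightarrow> ?row r = (\<Sum>u\<in>U. (\<lambda>x. a u * u x))"
      using U(3) unfolding fun_vs.span_finite[OF finU] by blast
  qed
  from choice[OF this]
  obtain a where a: "\<And>r. r \<in> R \<Longrightarrow> ?row r = (\<Sum>u\<in>U. (\<lambda>x. a r u * u x))"
    by blast
  \<comment> \<open>The vector of \<open>u\<close> lists the coefficients of \<open>u\<close> in the
    expansions of all rows; column \<open>c\<close> combines these vectors with coefficients
    \<open>u c\<close>.\<close>
  define W where "W = (\<lambda>u r. if r \<in> R then a r u else 0) ` U"
  have finW: "finite W" and cardW: "card W \<le> card U"
    using finU by (auto simp: W_def card_image_le)
  have "mat_col R B c \<in> fun_vs.span W" if "c \<in> C" for c
  proof -
    have "mat_col R B c = (\<Sum>u\<in>U. (\<lambda>r. u c * (if r \<in> R then a r u else 0)))"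
    proof
      fix r
      have "B r c = (\<Sum>u\<in>U. a r u * u c)" if "r \<in> R"
        using fun_cong[OF a[OF that], of c] \<open>c \<in> C\<close> by (simp add: mat_col_def sum_fun_apply)
      then show "mat_col R B c r = (\<Sum>u\<in>U. (\<lambda>r. u c * (if r \<in> R then a r u else 0))) r"
        by (simp add: mat_col_def sum_fun_apply mult.commute)
    qed
    also have "\<dots> \<in> fun_vs.span W"
      by (intro fun_vs.span_sum fun_vs.span_scale fun_vs.span_base) (auto simp: W_def)
    finally show ?thesis .
  qed
  then have "fun_vs.dim (mat_col R B ` C) \<le> card W"
    using finW by (intro fun_vs.dim_le_card) auto
  then show ?thesis using cardW U(4) by (simp add: mat_rank_def)
qed

lemma mat_rank_transpose:
  assumes "finite R" "finite C"
  shows "mat_rank R C B = mat_rank C R (\<lambda>c r. B r c)"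
  using mat_rank_le_transpose[OF assms(1), of C B]
    mat_rank_le_transpose[OF assms(2), of R "\<lambda>c r. B r c"] by simp

section \<open>Matroid rank as matrix rank\<close>

lemma matroid_rank_represented_matroid:
  assumes "finite C" "S \<subseteq> C"
  shows "matroid_rank (represented_matroid R C B) S = mat_rank R S B"
  unfolding matroid_rank_def
proof (rule Max_eqI)
  let ?c = "mat_col R B"
  let ?ind = "snd (represented_matroid R C B)"
  have finS: "finite S" using assms finite_subset by blast
  have "{card I |I. I \<in> ?ind \<and> I \<subseteq> S} \<subseteq> card ` Pow S" by auto
  then show "finite {card I |I. I \<in> ?ind \<and> I \<subseteq> S}"
    using finS finite_subset by blast
  show "k \<le> mat_rank R S B" if k: "k \<in> {card I |I. I \<in> ?ind \<and> I \<subseteq> S}" for k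
  proof -
    obtain I where I: "k = card I" "inj_on ?c I" "fun_vs.independent (?c ` I)" "I \<subseteq> S"
      using k by (auto simp: represented_matroid_def)
    have "card (?c ` I) \<le> fun_vs.dim (?c ` S)"
      using fun_vs_card_le_dim[of "?c ` S" "?c ` I"] finS I(3,4) fun_vs.span_superset[of "?c ` S"]
      by (meson finite_imageI image_mono subset_trans)
    then show ?thesis using I by (simp add: card_image mat_rank_def)
  qed
  obtain D where D: "D \<subseteq> ?c ` S" "fun_vs.independent D" "?c ` S \<subseteq> fun_vs.span D"
    "card D = fun_vs.dim (?c ` S)"
    by (rule fun_vs.basis_exists)
  \<comment> \<open>One label is chosen for each basis vector, so labels of equal columns are not
    taken twice.\<close>
  obtain I where I: "I \<subseteq> S" "inj_on ?c I" "D = ?c ` I"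
    using D(1) by (auto simp: subset_image_inj)
  have "I \<in> ?ind" using I D(2) assms(2) by (auto simp: represented_matroid_def)
  moreover have "mat_rank R S B = card I" using D(4) I by (simp add: mat_rank_def card_image)
  ultimately show "mat_rank R S B \<in> {card I |I. I \<in> ?ind \<and> I \<subseteq> S}" using I(1) by blast
qed

text \<open>These rules rewrite inside the scaling that parametrises the constants of the vector space
  interpretation over \<open>bit\<close>, after which no fact about them applies.\<close>

declare mult_bit_eq_and [simp del] add_bit_eq_xor [simp del] minus_bit_def [simp del]

section \<open>The isotropic matroid of a graph and its ranks\<close>

locale looped_graph =
  fixes V :: "'v set" and E :: "'v set set"
  assumes graph: "looped_simple_graph V E"
begin

abbreviation M :: "('v \<times> block) matroid" where "M \<equiv> isotropic_matroid V E"

abbreviation r :: "('v \<times> block) set \<Rightarrow> nat" where "r \<equiv> matroid_rank M"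

abbreviation \<tau> :: "'v set \<Rightarrow> ('v \<times> block) set" where "\<tau> X \<equiv> X \<times> UNIV"

abbreviation col :: "'v \<times> block \<Rightarrow> 'v \<Rightarrow> bit" where "col \<equiv> mat_col V (ias_mat E)"

abbreviation c :: "'v set \<Rightarrow> nat" where "c \<equiv> cut_rank V E"

lemma finite_V: "finite V"
  using graph by (simp add: looped_simple_graph_def)

lemma UNIV_block: "UNIV = {Block_I, Block_A, Block_AI}"
  using block.exhaust by auto

lemma finite_ground: "finite (\<tau> V :: ('v \<times> block) set)"
  using finite_V by (simp add: UNIV_block)

lemma finite_cols: "S \<subseteq> \<tau> V \<Longrightarrow> finite (col ` S)"
  using finite_ground finite_subset by blast

lemma fst_M [simp]: "fst M = \<tau> V"
  by (simp add: isotropic_matroid_def represented_matroid_def)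

lemma rank_eq_dim: "S \<subseteq> \<tau> V \<Longrightarrow> r S = fun_vs.dim (col ` S)"
  using matroid_rank_represented_matroid[OF finite_ground]
  by (simp add: isotropic_matroid_def mat_rank_def)

lemma rank_le_of_span:
  assumes "S \<subseteq> \<tau> V" "T \<subseteq> \<tau> V" "col ` S \<subseteq> fun_vs.span (col ` T)"
  shows "r S \<le> r T"
  using assms by (simp add: rank_eq_dim fun_vs_dim_le finite_cols)

lemma col_sum_zero: "col (v, Block_I) + col (v, Block_A) = col (v, Block_AI)"
  by (auto simp: mat_col_def fun_eq_iff add.commute)

lemma two_cols_span_third:
  assumes "(v, b) \<in> S" "(v, b') \<in> S" "b \<noteq> b'"
  shows "col (v, d) \<in> fun_vs.span (col ` S)"
proof -
  have base: "col (v, d) \<in> fun_vs.span (col ` S)" if "(v, d) \<in> S" for d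
    using that by (intro fun_vs.span_base) auto
  have "col (v, Block_AI) - col (v, Block_A) = col (v, Block_I)"
    "col (v, Block_AI) - col (v, Block_I) = col (v, Block_A)"
    using col_sum_zero[of v] by (auto simp: algebra_simps)
  then have "(v, Block_I) \<in> S \<Longrightarrow> (v, Block_A) \<in> S \<Longrightarrow> col (v, Block_AI) \<in> fun_vs.span (col ` S)"
    "(v, Block_A) \<in> S \<Longrightarrow> (v, Block_AI) \<in> S \<Longrightarrow> col (v, Block_I) \<in> fun_vs.span (col ` S)"
    "(v, Block_I) \<in> S \<Longrightarrow> (v, Block_AI) \<in> S \<Longrightarrow> col (v, Block_A) \<in> fun_vs.span (col ` S)"
    using base fun_vs.span_diff fun_vs.span_add col_sum_zero[of v] by metis+
  then show ?thesis
    using assms base by (cases b; cases b'; cases d) auto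
qed

lemma rank_tau:
  assumes "X \<subseteq> V"
  shows "r (\<tau> X) = card X + c X"
proof -
  \<comment> \<open>\<open>U\<close> holds the unit columns of \<open>X\<close>; \<open>P\<close>
    holds the adjacency columns with the rows in \<open>X\<close> cleared, so its dimension is the
    cut-rank by definition.\<close>
  define U where "U = (\<lambda>v. col (v, Block_I)) ` X"
  define P where "P = mat_col (V - X) (adj_mat E) ` X"
  have finX: "finite X" using assms finite_V finite_subset by blast
  have fin: "finite U" "finite P" using finX by (auto simp: U_def P_def)
  have unit: "col (v, Block_I) = (\<lambda>w. if w = v then 1 else 0)" if "v \<in> X" for v
    using that assms by (auto simp: mat_col_def id_mat_def fun_eq_iff)
  have inj: "inj_on (\<lambda>v. col (v, Block_I)) X"
    by (rule inj_onI) (metis unit zero_neq_one)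
  \<comment> \<open>Induction on \<open>Y\<close>: the new unit vector is 1 at \<open>y\<close>,
    where all earlier ones vanish.\<close>
  have ind: "fun_vs.independent (\<Union>v\<in>Y. {col (v, Block_I)})" if "Y \<subseteq> X" for Y
    using finite_subset[OF that finX] that
  proof (induction rule: finite_induct)
    case empty
    then show ?case by (simp add: fun_vs.independent_empty)
  next
    case (insert y Y)
    have "col (y, Block_I) \<notin> fun_vs.span (\<Union>v\<in>Y. {col (v, Block_I)})"
    proof
      assume "col (y, Block_I) \<in> fun_vs.span (\<Union>v\<in>Y. {col (v, Block_I)})"
      then have "col (y, Block_I) y = 0"
        by (rule fun_vs_span_zero_on[of _ _ "{y}"]) (use insert unit in auto)
      then show False using unit insert.prems by auto
    qed
    then show ?case using insert fun_vs.independent_insertI by auto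
  qed
  have "fun_vs.dim U = card U"
    using ind[of X] by (intro fun_vs.dim_eq_card_independent) (simp add: U_def UNION_singleton_eq_range)
  then have dimU: "fun_vs.dim U = card X" using inj by (simp add: U_def card_image)
  have dimP: "fun_vs.dim P = c X" by (simp add: P_def cut_rank_def mat_rank_def)
  \<comment> \<open>What clearing removes is the part of the column in the rows of \<open>X\<close>,
    a combination of unit vectors with the matrix entries as coefficients.\<close>
  have "mat_col V (adj_mat E) w - mat_col (V - X) (adj_mat E) w \<in> fun_vs.span U" for w
  proof -
    have "mat_col V (adj_mat E) w - mat_col (V - X) (adj_mat E) w
        = (\<Sum>v\<in>X. (\<lambda>x. adj_mat E v w * col (v, Block_I) x))"
    proof
      fix x
      have "(\<Sum>v\<in>X. adj_mat E v w * col (v, Block_I) x)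
          = (\<Sum>v\<in>X. if x = v then adj_mat E v w else 0)"
        by (rule sum.cong) (auto simp: unit)
      also have "\<dots> = (if x \<in> X then adj_mat E x w else 0)"
        using finX by simp
      finally show "(mat_col V (adj_mat E) w - mat_col (V - X) (adj_mat E) w) x
        = (\<Sum>v\<in>X. (\<lambda>x. adj_mat E v w * col (v, Block_I) x)) x"
        using assms by (auto simp: sum_fun_apply mat_col_def)
    qed
    also have "\<dots> \<in> fun_vs.span U"
      by (intro fun_vs.span_sum fun_vs.span_scale fun_vs.span_base) (auto simp: U_def)
    finally show ?thesis .
  qed
  then have diff: "mat_col V (adj_mat E) w - mat_col (V - X) (adj_mat E) w \<in> fun_vs.span K"
    if "U \<subseteq> K" for w K
    using that fun_vs.span_mono by blast
  have colA: "col (w, Block_A) = mat_col V (adj_mat E) w" for w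
    by (simp add: mat_col_def fun_eq_iff)
  have U_sub: "U \<subseteq> col ` \<tau> X" by (auto simp: U_def)
  have "fun_vs.dim (col ` \<tau> X) = fun_vs.dim (U \<union> P)"
  proof (rule fun_vs_dim_span_eq)
    show "finite (col ` \<tau> X)" using assms by (intro finite_cols) auto
    show "finite (U \<union> P)" using fin by simp
    show "col ` \<tau> X \<subseteq> fun_vs.span (U \<union> P)"
    proof clarify
      fix w b assume w: "w \<in> X"
      have I: "col (w, Block_I) \<in> fun_vs.span (U \<union> P)"
        using w by (intro fun_vs.span_base) (auto simp: U_def)
      have "mat_col (V - X) (adj_mat E) w \<in> fun_vs.span (U \<union> P)"
        using w by (intro fun_vs.span_base) (auto simp: P_def)
      then have A: "col (w, Block_A) \<in> fun_vs.span (U \<union> P)"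
        using fun_vs.span_add[OF diff[OF Un_upper1, of w]] unfolding colA by (metis diff_add_cancel)
      show "col (w, b) \<in> fun_vs.span (U \<union> P)"
        using I A fun_vs.span_add[OF I A] by (cases b) (simp_all add: col_sum_zero)
    qed
    show "U \<union> P \<subseteq> fun_vs.span (col ` \<tau> X)"
    proof
      fix f assume "f \<in> U \<union> P"
      then consider "f \<in> U" | w where "w \<in> X" "f = mat_col (V - X) (adj_mat E) w"
        by (auto simp: P_def)
      then show "f \<in> fun_vs.span (col ` \<tau> X)"
      proof cases
        case 1
        then show ?thesis using U_sub fun_vs.span_base by blast
      next
        case 2
        then have "col (w, Block_A) \<in> fun_vs.span (col ` \<tau> X)"
          by (intro fun_vs.span_base) auto
        from fun_vs.span_diff[OF this diff[OF U_sub, of w]] show ?thesis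
          using 2 by (simp add: colA)
      qed
    qed
  qed
  also have "\<dots> = fun_vs.dim U + fun_vs.dim P"
    by (rule fun_vs_dim_disjoint_support[OF fin, of X]) (auto simp: U_def P_def mat_col_def id_mat_def)
  finally show ?thesis
    using assms dimU dimP rank_eq_dim[of "\<tau> X"] by auto
qed

text \<open>The adjacency matrix is symmetric, so the two cut matrices are transposes of each
  other.\<close>

lemma cut_rank_complement:
  assumes "X \<subseteq> V"
  shows "c (V - X) = c X"
proof -
  have "V - (V - X) = X" using assms by auto
  moreover have "(\<lambda>v w. adj_mat E w v) = adj_mat E"
    by (simp add: adj_mat_def fun_eq_iff insert_commute)
  moreover have "finite X" "finite (V - X)" using assms finite_V finite_subset by auto
  ultimately show ?thesis
    using mat_rank_transpose[of X "V - X" "adj_mat E"] by (simp add: cut_rank_def)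
qed

lemma rank_ground: "r (\<tau> V) = card V"
proof -
  \<comment> \<open>For \<open>X = V\<close> the cut matrix has no rows, so its columns are
    zero.\<close>
  have "mat_col {} (adj_mat E) ` V \<subseteq> fun_vs.span {}"
    by (auto simp: mat_col_def fun_eq_iff fun_vs.span_empty)
  from fun_vs.dim_le_card[OF this]
  have "fun_vs.dim (mat_col {} (adj_mat E) ` V) = 0" by simp
  then show ?thesis using rank_tau[of V] by (simp add: cut_rank_def mat_rank_def)
qed

section \<open>Passing between isotropic and vertical separations\<close>

lemma card_complement: "X \<subseteq> V \<Longrightarrow> card X + card (V - X) = card V"
  using card_Un_disjoint[of X "V - X"] finite_V finite_subset[of X V] by (simp add: Un_absorb1)

text \<open>Here \<open>\<lambda>\<close> equals \<open>2 * c X = 2 * k - 2\<close>, and each side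
  has rank at least \<open>k + c X = 2 * k - 1\<close>. As \<open>k\<close> is positive, the
  subtraction does not truncate.\<close>

lemma vertical_separation_tau:
  assumes X: "isotropic_separation V E k X" and "c X + 1 = k"
  shows "vertical_separation M (2 * k - 1) (\<tau> X)"
proof -
  have XV: "X \<subseteq> V" and card: "card X \<ge> k" "card (V - X) \<ge> k"
    using X by (auto simp: isotropic_separation_def)
  have compl: "\<tau> V - \<tau> X = (\<tau> (V - X) :: ('v \<times> block) set)" by auto
  have "r (\<tau> X) = card X + c X" "r (\<tau> (V - X)) = card (V - X) + c X"
    using rank_tau[OF XV] rank_tau[of "V - X"] cut_rank_complement[OF XV] by auto
  then show ?thesis
    using XV card assms(2) card_complement[OF XV] rank_ground
    by (auto simp: vertical_separation_def matroid_lambda_def compl)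
qed

lemma isotropic_separation_of_vertical:
  assumes S: "vertical_separation M k S"
  shows "\<exists>j X. isotropic_separation V E j X \<and> 2 * j \<le> k + 1"
proof -
  define X where "X = {v \<in> V. \<exists>b b'. (v, b) \<in> S \<and> (v, b') \<in> S \<and> b \<noteq> b'}"
  have SV: "S \<subseteq> \<tau> V" and lam: "int (r S) + int (r (\<tau> V - S)) - int (card V) < int k"
    and rS: "r S \<ge> k" "r (\<tau> V - S) \<ge> k"
    using S by (auto simp: vertical_separation_def matroid_lambda_def rank_ground)
  have XV: "X \<subseteq> V" by (auto simp: X_def)
  have "r (\<tau> X) \<le> r S"
    by (rule rank_le_of_span) (use SV XV two_cols_span_third in \<open>auto simp: X_def\<close>)
  then have rX: "card X + c X \<le> r S" by (simp add: rank_tau[OF XV])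
  have two: "\<exists>b b'. (v, b) \<in> \<tau> V - S \<and> (v, b') \<in> \<tau> V - S \<and> b \<noteq> b'" if "v \<in> V - X" for v
  proof -
    have "\<not> ((v, b) \<in> S \<and> (v, b') \<in> S)" if "b \<noteq> b'" for b b'
      using \<open>v \<in> V - X\<close> that by (auto simp: X_def)
    \<comment> \<open>At most one of the three columns of \<open>v\<close> lies in \<open>S\<close>,
      so two are outside.\<close>
    then have "(v, Block_I) \<notin> S \<and> (v, Block_A) \<notin> S \<or> (v, Block_I) \<notin> S \<and> (v, Block_AI) \<notin> S
        \<or> (v, Block_A) \<notin> S \<and> (v, Block_AI) \<notin> S"
      by (metis block.distinct)
    then show ?thesis using that by (metis DiffD1 DiffI SigmaI UNIV_I block.distinct)
  qed
  have "col (v, d) \<in> fun_vs.span (col ` (\<tau> V - S))" if v: "v \<in> V - X" for v d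
  proof -
    obtain b b' where "(v, b) \<in> \<tau> V - S" "(v, b') \<in> \<tau> V - S" "b \<noteq> b'"
      using two[OF v] by blast
    then show ?thesis by (rule two_cols_span_third)
  qed
  then have "r (\<tau> (V - X)) \<le> r (\<tau> V - S)"
    by (intro rank_le_of_span) auto
  then have rY: "card (V - X) + c X \<le> r (\<tau> V - S)"
    using rank_tau[of "V - X"] cut_rank_complement[OF XV] by simp
  \<comment> \<open>Adding \<open>rX\<close> and \<open>rY\<close> bounds \<open>2 * c X\<close>. If
    \<open>card X \<le> c X\<close>, then \<open>rY\<close> gives the complement of \<open>S\<close>
    rank at least \<open>card V\<close>, and \<open>lam\<close> forces \<open>r S < k\<close>; the
    other side is symmetric.\<close>
  have "c X < card X" "c X < card (V - X)" "2 * c X < k"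
    using rX rY lam rS card_complement[OF XV] by linarith+
  then have "isotropic_separation V E (c X + 1) X" "2 * (c X + 1) \<le> k + 1"
    using XV by (auto simp: isotropic_separation_def)
  then show ?thesis by blast
qed

text \<open>The second conclusion places the connectivity of \<open>M\<close> strictly below
  \<open>card V\<close>, which selects the finite case of the formula.\<close>

lemma vertical_connectivity_of_isotropic:
  assumes "isotropic_separation V E j0 X0"
  defines "k \<equiv> LEAST k. \<exists>X. isotropic_separation V E k X"
  shows "vertical_connectivity M + 1 = 2 * k" "2 * k \<le> card V"
proof -
  have "\<exists>X. isotropic_separation V E k X"
    unfolding k_def by (rule LeastI_ex) (use assms(1) in blast)
  then obtain X where X: "isotropic_separation V E k X" by blast
  have least: "k \<le> j" if "isotropic_separation V E j Y" for j Y
    unfolding k_def by (rule Least_le) (use that in blast)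
  have sep: "X \<subseteq> V" "card X \<ge> k" "card (V - X) \<ge> k" "c X < k"
    using X by (auto simp: isotropic_separation_def)
  \<comment> \<open>The order of \<open>X\<close> can be lowered to \<open>c X + 1\<close>, so
    minimality of \<open>k\<close> forces equality.\<close>
  have "isotropic_separation V E (c X + 1) X"
    using sep by (auto simp: isotropic_separation_def)
  then have ck: "c X + 1 = k" using least sep(4) by fastforce
  show le: "2 * k \<le> card V" using sep card_complement[of X] by linarith
  have "vertical_connectivity M = 2 * k - 1"
    unfolding vertical_connectivity_def
  proof (rule Least_equality)
    show "2 * k - 1 \<in> {k. \<exists>S. vertical_separation M k S} \<union> {r (fst M)}"
      using vertical_separation_tau[OF X ck] by blast
    fix m assume "m \<in> {k. \<exists>S. vertical_separation M k S} \<union> {r (fst M)}"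
    then consider S where "vertical_separation M m S" | "m = card V"
      by (auto simp: rank_ground)
    then show "2 * k - 1 \<le> m"
    proof cases
      case 1
      then obtain j Y where "isotropic_separation V E j Y" "2 * j \<le> m + 1"
        using isotropic_separation_of_vertical by blast
      then show ?thesis using least[of j Y] by linarith
    next
      case 2
      then show ?thesis using le by simp
    qed
  qed
  then show "vertical_connectivity M + 1 = 2 * k" using ck by simp
qed

text \<open>Every vertical separation would yield an isotropic one, so only the rank of
  \<open>M\<close> remains as a candidate for the minimum.\<close>

lemma vertical_connectivity_no_isotropic:
  assumes "\<nexists>k X. isotropic_separation V E k X"
  shows "vertical_connectivity M = card V"
proof -
  have "\<nexists>k S. vertical_separation M k S"
    using assms isotropic_separation_of_vertical by blast
  then show ?thesis
    unfolding vertical_connectivity_def by (intro Least_equality) (auto simp: rank_ground)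
qed

end

theorem theorem4:
  fixes V :: "'v set" and E :: "'v set set" and n :: nat and M :: "('v \<times> block) matroid"
  assumes "looped_simple_graph V E"
    and "n = card V"
    and "M = isotropic_matroid V E"
  shows "ereal_of_enat (isotropic_connectivity V E) =
    (if vertical_connectivity M < n then ereal ((real (vertical_connectivity M) + 1) / 2) else \<infinity>)"
proof -
  interpret looped_graph V E by unfold_locales (rule assms(1))
  show ?thesis
  \<comment> \<open>Either case settles the comparison with \<open>n\<close>: strictly below if a
    separation exists, equal otherwise.\<close>
  proof (cases "\<exists>k X. isotropic_separation V E k X")
    case True
    define k where "k = (LEAST k. \<exists>X. isotropic_separation V E k X)"
    from True obtain j X where "isotropic_separation V E j X" by blast
    from vertical_connectivity_of_isotropic[OF this]
    have "vertical_connectivity M + 1 = 2 * k" "2 * k \<le> n"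
      using assms(2,3) by (simp_all add: k_def)
    then have "vertical_connectivity M < n" "real (vertical_connectivity M) + 1 = 2 * real k"
      by linarith+
    then show ?thesis using True by (simp add: isotropic_connectivity_def k_def)
  next
    case False
    then show ?thesis
      using vertical_connectivity_no_isotropic assms(2,3) by (simp add: isotropic_connectivity_def)
  qed
qed

end
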